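(* Let $p(z)=a_dz^d+\dots+a_1z+a_0\in\mathbb{Z}[z]$ with $d\ge 1$ and $a_d>0$. Let $\phi:\mathbb{N}\to\{-1,1\}$ be a 2-colouring such that $x+y=p(z)$ does not have infinitely many monochromatic solutions. Then there exist an even positive integer $m$ and a partition of $\mathbb{Z}_m$ into two classes $A$ and $B$, each of size $m/2$, such that for every $x\in\mathbb{N}$, $$\phi(x)=-1\quad\text{if and only if}\quad x \bmod m\in A.$$ Furthermore, there exists an odd $\alpha\in\mathbb{Z}_m$ such that $$A+A=B+B=\mathbb{Z}_m\setminus\{\alpha\},$$ and for every $z\in\mathbb{N}$ we have $p(z)\equiv\alpha\pmod m$.
   Context: $\mathbb{N}=\{1,2,3,\dots\}$ and $\mathbb{Z}_m=\mathbb{Z}/m\mathbb{Z}$. A monochromatic solution of $x+y=p(z)$ is a triple $(x,y,z)\in\mathbb{N}^3$ (not necessarily distinct entries) with $x+y=p(z)$ and $\phi(x)=\phi(y)=\phi(z)$. For $S\subseteq\mathbb{Z}_m$, $S+S=\{s+s':s,s'\in S\}$. Since $m$ is even, the parity of an element of $\mathbb{Z}_m$ is well defined. *)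

theory Defs
  imports "HOL-Number_Theory.Residues" "HOL-Computational_Algebra.Polynomial"
begin

text \<open>
  The positive integers are the elements of \<open>{1..}\<close> of type \<open>nat\<close>; the value of a colouring
  at \<open>0\<close> plays no role. The ring of integers modulo \<open>m\<close> is the library's \<open>residue_ring m\<close>,
  whose carrier is the set \<open>{0..m - 1}\<close> of least nonnegative residues, with addition modulo \<open>m\<close>;
  the sumset of two subsets is \<open>set_add\<close>.
\<close>

definition two_colouring :: "(nat \<Rightarrow> int) \<Rightarrow> bool" where
  "two_colouring \<phi> \<longleftrightarrow> (\<forall>x\<ge>1. \<phi> x \<in> {-1, 1})"

definition mono_solutions :: "(nat \<Rightarrow> int) \<Rightarrow> int poly \<Rightarrow> (nat \<times> nat \<times> nat) set" where
  "mono_solutions \<phi> p =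
     {(x, y, z). x \<ge> 1 \<and> y \<ge> 1 \<and> z \<ge> 1 \<and>
        int x + int y = poly p (int z) \<and> \<phi> x = \<phi> y \<and> \<phi> y = \<phi> z}"

end

theory Submission
  imports Defs
begin

text \<open>Write \<open>\<chi> z\<close> for \<open>\<phi> z = -1\<close> and \<open>D z = p (z + 1) - p z\<close>. For large \<open>z\<close>, if \<open>\<chi> x = \<chi> z\<close> then
  \<open>\<chi> (p z - x) \<noteq> \<chi> z\<close>. Applying this at \<open>z\<close> and at \<open>z + 1\<close>, where \<open>\<chi>\<close> changes, shows that on
  \<open>[1, p (z + 1))\<close> the shift by \<open>D z\<close> preserves the colour of \<open>z\<close>. Two comparable changes \<open>v \<le> v'\<close>
  of opposite kinds give one shift that preserves true and one that preserves false; both are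
  short compared with \<open>p v\<close>, and together they force \<open>\<chi>\<close> to have period \<open>D v'\<close> on
  \<open>[1, p (v + 1))\<close>. Modulo this period all reflections \<open>x \<mapsto> p z - x\<close> with \<open>z\<close> near \<open>v\<close> exchange
  the colours, so the differences \<open>p (z + 1) - p z\<close> are periods as well, and iterated differences
  leave a constant period independent of \<open>v\<close>. Hence \<open>\<chi>\<close> is periodic. Modulo the minimal period,
  \<open>p\<close> is constant, and the reflection in its value \<open>\<alpha>\<close> exchanges the classes; another
  \<open>\<gamma>\<close> missing from \<open>A + A\<close> would make \<open>\<alpha> - \<gamma>\<close> a period.\<close>

section \<open>The subgroup of periods of a predicate on the integers\<close>

definition periods :: "(int \<Rightarrow> bool) \<Rightarrow> int set" where
  "periods f = {h. \<forall>x. f (x + h) = f x}"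

lemma periods_zero: "0 \<in> periods f"
  by (simp add: periods_def)

lemma periods_add: "a \<in> periods f \<Longrightarrow> b \<in> periods f \<Longrightarrow> a + b \<in> periods f"
  unfolding periods_def by (simp add: add.assoc[symmetric])

lemma periods_uminus: "a \<in> periods f \<Longrightarrow> - a \<in> periods f"
  unfolding periods_def by simp (metis diff_add_cancel)

lemma periods_diff: "a \<in> periods f \<Longrightarrow> b \<in> periods f \<Longrightarrow> a - b \<in> periods f"
  using periods_add[of a f "- b"] periods_uminus[of b f] by simp

lemma periods_mult: "a \<in> periods f \<Longrightarrow> k * a \<in> periods f"
proof (induction k rule: int_induct[of _ 0])
  case base
  show ?case by (simp add: periods_zero)
next
  case (step1 i)
  then show ?case using periods_add by (simp add: distrib_right)
next
  case (step2 i)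
  then show ?case using periods_diff by (simp add: left_diff_distrib)
qed

lemma periods_shift: "h \<in> periods f \<Longrightarrow> f (x + h) = f x"
  by (simp add: periods_def)

lemma periods_mod: "m \<in> periods f \<Longrightarrow> f (x mod m) = f x"
  using periods_shift[OF periods_mult, of m f "x mod m" "x div m"] by (simp add: mod_div_mult_eq)

text \<open>The implication reverses because the orbit closes up: from \<open>x + h\<close>, another
  \<open>n - 1\<close> shifts lead to \<open>x + h * n\<close>, which has the same value as
  \<open>x\<close>.\<close>

lemma monotone_shift_in_periods:
  assumes n: "n > 0" "n \<in> periods f" and mono: "\<And>x. f x \<Longrightarrow> f (x + h)"
  shows "h \<in> periods f"
proof -
  have it: "f x \<Longrightarrow> f (x + int k * h)" for x k
  proof (induction k)
    case (Suc k)
    then show ?case using mono[of "x + int k * h"] by (simp add: algebra_simps)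
  qed simp
  have "f (x + h) = f x" for x
  proof
    assume "f (x + h)"
    then have "f (x + h + int (nat (n - 1)) * h)" by (rule it)
    also have "x + h + int (nat (n - 1)) * h = x + h * n"
      using n by (simp add: algebra_simps)
    finally show "f x" using periods_shift[OF periods_mult[OF n(2)]] by simp
  qed (rule mono)
  then show ?thesis by (simp add: periods_def)
qed

text \<open>Reflecting in \<open>q\<close> and then in \<open>r\<close> is the shift by
  \<open>r - q\<close>. It preserves truth, and in the presence of a period a shift that preserves
  truth is itself a period.\<close>

lemma reflections_differ_by_period:
  assumes "n > 0" "n \<in> periods f"
    and "\<And>x. f x \<Longrightarrow> \<not> f (q - x)" and "\<And>x. \<not> f x \<Longrightarrow> f (r - x)"
  shows "r - q \<in> periods f"
proof (rule monotone_shift_in_periods[OF assms(1,2)])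
  fix x assume "f x"
  then have "f (r - (q - x))" using assms(3,4) by blast
  then show "f (x + (r - q))" by (simp add: algebra_simps)
qed

section \<open>Shifts acting on a bounded interval\<close>

text \<open>A shift by \<open>s\<close> and a backward shift by \<open>t\<close> amount to a rotation of every window of length
  \<open>s + t\<close>.\<close>

lemma opposite_shifts_imp_period:
  fixes \<chi> :: "int \<Rightarrow> bool"
  assumes st: "s > 0" "t > 0" "s + t \<le> N"
    and up: "\<And>x. 1 \<le> x \<Longrightarrow> x + s \<le> N \<Longrightarrow> \<chi> x \<Longrightarrow> \<chi> (x + s)"
    and down: "\<And>x. 1 \<le> x \<Longrightarrow> x + t \<le> N \<Longrightarrow> \<chi> (x + t) \<Longrightarrow> \<chi> x"
    and x: "1 \<le> x" "x + s \<le> N"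
  shows "\<chi> (x + s) = \<chi> x"
proof -
  \<comment> \<open>The window \<open>c, ..., c + s + t - 1\<close> starts at \<open>x\<close> when
    it fits and is otherwise pushed left until it ends at \<open>N\<close>. In either case
    \<open>x - c < t\<close>, so the step from \<open>x\<close> to \<open>x + s\<close> does not
    wrap around.\<close>
  define c where "c = min x (N - s - t + 1)"
  define f where "f y = \<chi> (c + y mod (s + t))" for y
  have c: "1 \<le> c" "c + s + t \<le> N + 1" using st x by (auto simp: c_def)
  have "s \<in> periods f"
  proof (rule monotone_shift_in_periods[of "s + t"])
    fix y assume fy: "f y"
    define r where "r = y mod (s + t)"
    have r: "0 \<le> r" "r < s + t" using st by (auto simp: r_def)
    have ys: "(y + s) mod (s + t) = (r + s) mod (s + t)" by (simp add: r_def mod_add_left_eq)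
    show "f (y + s)"
    proof (cases "r < t")
      case True
      then have "(y + s) mod (s + t) = r + s" using ys r st by simp
      then show ?thesis using up[of "c + r"] fy c r True by (simp add: f_def r_def add.assoc)
    next
      case False
      have "(r + s) mod (s + t) = r - t"
        using mod_add_self2[of "r - t" "s + t"] mod_pos_pos_trivial[of "r - t" "s + t"] False r st by simp
      then have "f (y + s) = \<chi> (c + r - t)" using ys by (simp add: f_def add_diff_eq)
      then show ?thesis using down[of "c + r - t"] fy c r False by (simp add: f_def r_def)
    qed
  qed (use st in \<open>auto simp: periods_def f_def\<close>)
  then have "f (x - c + s) = f (x - c)" by (rule periods_shift)
  moreover have "0 \<le> x - c" "x - c < t" using x st by (auto simp: c_def)
  ultimately show ?thesis using st by (simp add: f_def add.commute)
qed

text \<open>This allows \<chi> to be replaced on \<open>1, ..., N\<close> by a predicate that is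
  periodic on all integers, where the group of periods is available. The offset by 1 selects the
  representative in \<open>1, ..., s\<close>, since intervals start at 1.\<close>

lemma shift_invariant_cong:
  fixes \<chi> :: "int \<Rightarrow> bool"
  assumes "s > 0" and per: "\<And>x. 1 \<le> x \<Longrightarrow> x + s \<le> N \<Longrightarrow> \<chi> (x + s) = \<chi> x"
    and x: "1 \<le> x" "x \<le> N"
  shows "\<chi> ((x - 1) mod s + 1) = \<chi> x"
proof -
  have it: "r + int k * s \<le> N \<Longrightarrow> \<chi> (r + int k * s) = \<chi> r" if "1 \<le> r" for r k
  proof (induction k)
    case (Suc k)
    have "\<chi> (r + int k * s + s) = \<chi> (r + int k * s)"
    proof (rule per)
      have "0 \<le> int k * s" using \<open>s > 0\<close> by simp
      then show "1 \<le> r + int k * s" using that by linarith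
    qed (use Suc.prems in \<open>simp add: algebra_simps\<close>)
    then show ?case using Suc \<open>s > 0\<close> by (simp add: algebra_simps)
  qed simp
  have "(x - 1) div s \<ge> 0" using x \<open>s > 0\<close> by (simp add: pos_imp_zdiv_nonneg_iff)
  then have e: "x = ((x - 1) mod s + 1) + int (nat ((x - 1) div s)) * s"
    using mult_div_mod_eq[of s "x - 1"] by (simp add: mult.commute)
  have "1 \<le> (x - 1) mod s + 1" using \<open>s > 0\<close> by simp
  from it[OF this, of "nat ((x - 1) div s)", folded e] x show ?thesis by simp
qed

lemma periodic_extension:
  "s \<in> periods (\<lambda>x. \<chi> ((x - 1) mod s + 1))"
proof -
  have "(x + s - 1) mod s = (x - 1) mod s" for x
    using mod_add_self2[of "x - 1" s] by (simp add: algebra_simps)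
  then show ?thesis by (simp add: periods_def)
qed

section \<open>Growth and finite differences of integer polynomials\<close>

lemma poly_eventually_ge:
  fixes q :: "int poly"
  assumes "lead_coeff q > 0" "degree q \<ge> 1"
  shows "eventually (\<lambda>x. poly q x \<ge> M) at_top"
  using assms
proof (induction q arbitrary: M)
  case (pCons a q)
  have q0: "q \<noteq> 0" using pCons.prems by auto
  then have lc: "lead_coeff q > 0" using pCons.prems by simp
  have "eventually (\<lambda>x. poly q x \<ge> 1) at_top"
  proof (cases "degree q = 0")
    case True
    then obtain c where "q = [:c:]" using degree_0_id by metis
    then show ?thesis using lc by (auto simp: eventually_at_top_linorder)
  qed (use pCons.IH lc in simp)
  then show ?case using eventually_ge_at_top[of "max 0 (M - a)"]
  proof eventually_elim
    case (elim x)
    then have "x * 1 \<le> x * poly q x" by (intro mult_left_mono) auto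
    then show ?case using elim by simp
  qed
qed simp

lemma poly_eventually_pos:
  fixes q :: "int poly"
  assumes "lead_coeff q > 0"
  shows "eventually (\<lambda>x. poly q x > 0) at_top"
proof (cases "degree q = 0")
  case True
  then obtain c where "q = [:c:]" using degree_0_id by metis
  then show ?thesis using assms by simp
next
  case False
  then have "eventually (\<lambda>x. poly q x \<ge> 1) at_top"
    using assms by (intro poly_eventually_ge) auto
  then show ?thesis by eventually_elim simp
qed

text \<open>Keeping the forward difference as a polynomial lets it be iterated while degree and
  leading coefficient are tracked.\<close>

definition poly_diff :: "int poly \<Rightarrow> int poly" where
  "poly_diff p = pcompose p [:1, 1:] - p"

lemma poly_poly_diff: "poly (poly_diff p) x = poly p (x + 1) - poly p x"
  by (simp add: poly_diff_def poly_pcompose add.commute)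

lemma poly_diff_degree:
  assumes "degree p = Suc n"
  shows "degree (poly_diff p) = n \<and> lead_coeff (poly_diff p) = int (Suc n) * lead_coeff p"
  using assms
proof (induction p arbitrary: n)
  case (pCons a q)
  have q0: "q \<noteq> 0" using pCons.prems by auto
  then have dq: "degree q = n" using pCons.prems by simp
  have lq: "lead_coeff q \<noteq> 0" using q0 by simp
  \<comment> \<open>The product rule for differences of \<open>a + x * q x\<close>. Both summands
    contribute to the coefficient at \<open>n\<close>, with factors \<open>n\<close> and 1, whence
    \<open>Suc n\<close>.\<close>
  have eq: "poly_diff (pCons a q) = pCons 0 (poly_diff q) + pcompose q [:1, 1:]"
    by (simp add: poly_diff_def pcompose_pCons algebra_simps)
  have c: "coeff (pcompose q [:1, 1:]) n = lead_coeff q" "degree (pcompose q [:1, 1:]) = n"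
    using lead_coeff_comp[of "[:1, 1::int:]" q] dq by (auto simp: degree_pcompose)
  have "degree (poly_diff (pCons a q)) \<le> n \<and>
        coeff (poly_diff (pCons a q)) n = int (Suc n) * lead_coeff q"
  proof (cases n)
    case 0
    then obtain b where "q = [:b:]" using dq degree_0_id by metis
    then have "poly_diff q = 0" by (simp add: poly_diff_def)
    then show ?thesis using eq c 0 by simp
  next
    case (Suc k)
    then have ih: "degree (poly_diff q) = k" "lead_coeff (poly_diff q) = int n * lead_coeff q"
      using pCons.IH[of k] dq by auto
    have "degree (poly_diff (pCons a q)) \<le> n"
      unfolding eq using c ih Suc by (intro degree_add_le) (auto intro: order.trans[OF degree_pCons_le])
    moreover have "coeff (poly_diff (pCons a q)) n = int (Suc n) * lead_coeff q"
      unfolding eq using c ih Suc by (simp add: algebra_simps)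
    ultimately show ?thesis by simp
  qed
  moreover from this have "n \<le> degree (poly_diff (pCons a q))"
    using lq by (intro le_degree) auto
  ultimately show ?case using q0 by auto
qed simp

lemma diff_dvd_poly_diff: "x - y dvd poly p x - poly p y"
  for x y :: int
proof (induction p)
  case (pCons a p)
  have "poly (pCons a p) x - poly (pCons a p) y = x * (poly p x - poly p y) + (x - y) * poly p y"
    by (simp add: algebra_simps)
  then show ?case using pCons.IH by (metis dvd_add dvd_mult dvd_triv_left)
qed simp

lemma poly_diff_lead_coeff_pos:
  assumes "degree p \<ge> 1" "lead_coeff p > 0"
  shows "lead_coeff (poly_diff p) > 0" "degree (poly_diff p) = degree p - 1"
  using poly_diff_degree[of p "degree p - 1"] assms by auto

lemma poly_eventually_mono:
  fixes q :: "int poly"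
  assumes "lead_coeff q > 0"
  shows "eventually (\<lambda>x. \<forall>y\<ge>x. poly q x \<le> poly q y) at_top"
proof -
  have "eventually (\<lambda>x. poly q (x + 1) \<ge> poly q x) at_top"
  proof (cases "degree q = 0")
    case True
    then obtain c where "q = [:c:]" using degree_0_id by metis
    then show ?thesis by simp
  next
    case False
    then have "eventually (\<lambda>x. poly (poly_diff q) x > 0) at_top"
      using assms by (intro poly_eventually_pos poly_diff_lead_coeff_pos) auto
    then show ?thesis by eventually_elim (simp add: poly_poly_diff)
  qed
  then obtain n where n: "\<And>x. x \<ge> n \<Longrightarrow> poly q (x + 1) \<ge> poly q x"
    by (auto simp: eventually_at_top_linorder)
  have "poly q x \<le> poly q y" if "n \<le> x" "x \<le> y" for x y
    using that(2)
  proof (induction y rule: int_ge_induct)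
    case (step y)
    then show ?case using n[of y] that by simp
  qed simp
  then show ?thesis by (auto simp: eventually_at_top_linorder)
qed

text \<open>The witness is the leading coefficient times the factorial of the degree, the iterated finite
  difference of \<open>q\<close>.\<close>

lemma finite_difference_period:
  fixes q :: "int poly"
  assumes "lead_coeff q > 0"
  shows "\<exists>K>0. \<forall>w f. (\<forall>i\<in>{w..w + int (degree q)}. poly q i \<in> periods f) \<longrightarrow> K \<in> periods f"
  using assms
proof (induction "degree q" arbitrary: q)
  case 0
  then obtain c where "q = [:c:]" using degree_0_id by metis
  then show ?case using 0 by auto
next
  case (Suc n)
  have d: "lead_coeff (poly_diff q) > 0" "degree (poly_diff q) = n"
    using poly_diff_lead_coeff_pos[of q] Suc.prems Suc.hyps(2) by auto
  then obtain K where K: "K > 0"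
    "\<And>w f. \<forall>i\<in>{w..w + int n}. poly (poly_diff q) i \<in> periods f \<Longrightarrow> K \<in> periods f"
    using Suc.hyps(1)[of "poly_diff q"] by auto
  have "K \<in> periods f" if "\<forall>i\<in>{w..w + int (degree q)}. poly q i \<in> periods f" for w f
    using that Suc.hyps(2)[symmetric] by (intro K(2)[of w]) (auto simp: poly_poly_diff intro!: periods_diff)
  then show ?case using K(1) by blast
qed

section \<open>Colour changes and the shifts they induce\<close>

lemma colour_change_between:
  fixes \<chi> :: "int \<Rightarrow> bool"
  assumes "a \<le> b" "\<chi> a = c" "\<chi> b \<noteq> c"
  shows "\<exists>v. a \<le> v \<and> v < b \<and> \<chi> v = c \<and> \<chi> (v + 1) \<noteq> c"
  using assms(1,3)
proof (induction b rule: int_ge_induct)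
  case (step b)
  show ?case
  proof (cases "\<chi> b = c")
    case True
    then show ?thesis using step by (intro exI[of _ b]) auto
  next
    case False
    then obtain v where "a \<le> v \<and> v < b \<and> \<chi> v = c \<and> \<chi> (v + 1) \<noteq> c" using step by blast
    then show ?thesis by (intro exI[of _ v]) auto
  qed
qed (use assms in auto)

text \<open>Finiteness of the solution set enters through \<open>avoid\<close>, with
  \<open>z0\<close> beyond all third entries of solutions. Integer arguments keep shifts and
  reflections free of truncation.\<close>

locale sum_avoiding =
  fixes p :: "int poly" and \<chi> :: "int \<Rightarrow> bool" and z0 :: int
  assumes deg: "degree p \<ge> 1" and lead: "lead_coeff p > 0"
    and avoid: "\<And>x z. z \<ge> z0 \<Longrightarrow> 1 \<le> x \<Longrightarrow> x < poly p z \<Longrightarrow> \<chi> x = \<chi> z \<Longrightarrow> \<chi> (poly p z - x) \<noteq> \<chi> z"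
begin

text \<open>If one colour held from \<open>M\<close> on, a large \<open>z\<close> would make
  \<open>x\<close>, \<open>p z - x\<close> and \<open>z\<close> all lie beyond \<open>M\<close> and
  so form a forbidden solution.\<close>

lemma colour_unbounded: "\<exists>x\<ge>M. \<chi> x = c"
proof (rule ccontr)
  assume "\<not> ?thesis"
  then have all: "\<And>x. x \<ge> M \<Longrightarrow> \<chi> x = (\<not> c)" by auto
  define x where "x = max M 1"
  have "eventually (\<lambda>z. poly p z \<ge> 2 * x \<and> z \<ge> max M z0) at_top"
    by (intro eventually_conj poly_eventually_ge deg lead eventually_ge_at_top)
  then obtain z where z: "poly p z \<ge> 2 * x" "z \<ge> M" "z \<ge> z0"
    by (auto simp: eventually_at_top_linorder)
  have "\<chi> x = \<chi> z" "\<chi> (poly p z - x) = \<chi> z" using z by (simp_all add: all x_def)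
  moreover have "x < poly p z" "1 \<le> x" using z(1) unfolding x_def by linarith+
  ultimately show False using avoid[of z x] z by simp
qed

lemma colour_change_unbounded: "\<exists>v\<ge>M. \<chi> v = c \<and> \<chi> (v + 1) \<noteq> c"
proof -
  obtain a where a: "a \<ge> M" "\<chi> a = c" using colour_unbounded by blast
  obtain b where b: "b \<ge> a" "\<chi> b \<noteq> c" using colour_unbounded[of a "\<not> c"] by blast
  show ?thesis using colour_change_between[OF b(1) a(2) b(2)] a(1) order.trans by blast
qed

abbreviation "D \<equiv> poly (poly_diff p)"

text \<open>The shift is a composition of two reflections: \<open>p z - x\<close> has the colour
  opposite to \<open>z\<close>, which is that of \<open>z + 1\<close>, and reflecting it in
  \<open>p (z + 1)\<close> restores the colour of \<open>z\<close>.\<close>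

lemma shift_at_change:
  assumes "z \<ge> z0" "\<chi> (z + 1) \<noteq> \<chi> z" "D z > 0" "1 \<le> x" "x < poly p z" "\<chi> x = \<chi> z"
  shows "\<chi> (x + D z) = \<chi> z"
proof -
  have "\<chi> (poly p z - x) = \<chi> (z + 1)" using avoid[of z x] assms by auto
  then have "\<chi> (poly p (z + 1) - (poly p z - x)) \<noteq> \<chi> (z + 1)"
    using assms by (intro avoid) (auto simp: poly_poly_diff)
  then show ?thesis using assms by (simp add: poly_poly_diff algebra_simps)
qed

text \<open>If \<open>degree p \<ge> 2\<close> and \<open>\<chi>\<close> changes from true to false at \<open>z\<close>, then \<open>p z / 2\<close> is false,
  \<open>p (z + 1) / 2\<close> is true and \<open>p z - x\<close> is false for a fixed true \<open>x\<close>, up to rounding.\<close>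

lemma close_changes:
  "\<exists>v\<ge>M. \<exists>v'\<ge>v. \<not> \<chi> v \<and> \<chi> (v + 1) \<and> \<chi> v' \<and> \<not> \<chi> (v' + 1) \<and> (v' \<le> 2 * v + 1 \<or> degree p = 1)"
proof (cases "degree p = 1")
  case True
  obtain v where v: "v \<ge> M" "\<not> \<chi> v" "\<chi> (v + 1)" using colour_change_unbounded[of M False] by auto
  obtain v' where "v' \<ge> v" "\<chi> v'" "\<not> \<chi> (v' + 1)" using colour_change_unbounded[of v True] by auto
  with v True show ?thesis by blast
next
  case False
  then have deg2: "degree (poly_diff p) \<ge> 1" "lead_coeff (poly_diff p) > 0" 
    using poly_diff_lead_coeff_pos[OF deg lead] deg by auto
  obtain x where x: "x \<ge> 1" "\<chi> x" using colour_unbounded[of 1 True] by auto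
  \<comment> \<open>Subtracting the difference keeps the leading term, so \<open>p z - D z\<close>
    is eventually large. This puts \<open>p (z + 1) / 2\<close> to the left of
    \<open>p z - x\<close>, while \<open>D z \<ge> 3\<close> keeps it to the right of
    \<open>p z / 2\<close>.\<close>
  have deg': "degree (p - poly_diff p) = degree p" "lead_coeff (p - poly_diff p) = lead_coeff p"
  proof -
    have "degree (- poly_diff p) < degree p" using poly_diff_lead_coeff_pos[OF deg lead] deg by simp
    then show "degree (p - poly_diff p) = degree p" "lead_coeff (p - poly_diff p) = lead_coeff p"
      using degree_add_eq_left[of "- poly_diff p" p] lead_coeff_add_le[of "- poly_diff p" p]
        coeff_eq_0[of "poly_diff p" "degree p"] by auto
  qed
  have "eventually (\<lambda>z. D z \<ge> 3 \<and> poly (p - poly_diff p) z \<ge> 2 * x + 2 \<and>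
          poly p z \<ge> 2 * M + 2 \<and> poly p z \<ge> 4 \<and> z \<ge> z0) at_top"
    using deg2 deg' deg lead
    by (intro eventually_conj poly_eventually_ge eventually_ge_at_top) auto
  then obtain n where n: "\<And>z. z \<ge> n \<Longrightarrow> D z \<ge> 3 \<and> poly (p - poly_diff p) z \<ge> 2 * x + 2 \<and>
          poly p z \<ge> 2 * M + 2 \<and> poly p z \<ge> 4 \<and> z \<ge> z0"
    by (auto simp: eventually_at_top_linorder)
  obtain z where z: "z \<ge> n" "\<chi> z" "\<not> \<chi> (z + 1)"
    using colour_change_unbounded[of n True] by auto
  note nz = n[OF z(1)]
  \<comment> \<open>If the rounded half of \<open>p w\<close> has the colour of \<open>w\<close>,
    its reflection does not, and the reflection is the half rounded the other way.\<close>
  have half: "\<exists>y. \<chi> y \<noteq> \<chi> w \<and> \<bar>2 * y - poly p w\<bar> \<le> 1" if "w \<ge> z0" "poly p w \<ge> 4" for w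
  proof (cases "\<chi> (poly p w div 2) = \<chi> w")
    case True
    then show ?thesis using avoid[of w "poly p w div 2"] that
      by (intro exI[of _ "poly p w - poly p w div 2"]) auto
  next
    case False
    then show ?thesis by (intro exI[of _ "poly p w div 2"]) auto
  qed
  obtain x0 where x0: "\<not> \<chi> x0" "\<bar>2 * x0 - poly p z\<bar> \<le> 1" using half[of z] nz z by auto
  obtain x1 where x1: "\<chi> x1" "\<bar>2 * x1 - poly p (z + 1)\<bar> \<le> 1"
    using half[of "z + 1"] nz z n[of "z + 1"] by auto
  have y: "\<not> \<chi> (poly p z - x)" using avoid[of z x] x z nz by auto
  have pz: "poly p (z + 1) = poly p z + D z" by (simp add: poly_poly_diff)
  have le: "x0 \<le> x1" "x1 \<le> poly p z - x" using x0 x1 nz pz by auto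
  obtain v where v: "x0 \<le> v" "v < x1" "\<not> \<chi> v" "\<chi> (v + 1)"
    using colour_change_between[of x0 x1 \<chi> False] le x0 x1 by auto
  obtain v' where v': "x1 \<le> v'" "v' < poly p z - x" "\<chi> v'" "\<not> \<chi> (v' + 1)"
    using colour_change_between[of x1 "poly p z - x" \<chi> True] le x1 y by auto
  have "v \<ge> M" "v' \<ge> v" "v' \<le> 2 * v + 1" using v v' x0 nz x by auto
  then show ?thesis using v v' by blast
qed

section \<open>From local periods to a global one\<close>

lemma difference_eventually_small:
  "eventually (\<lambda>v. 2 * D (2 * v + 1) < poly p (v - int (degree p))) at_top"
proof -
  let ?q = "pcompose p [:- int (degree p), 1:]"
  let ?r = "smult (- 2) (pcompose (poly_diff p) [:1, 2:])"
  \<comment> \<open>Differencing lowers the degree, and the linear substitutions preserve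
    it.\<close>
  have "degree ?r < degree p"
    using poly_diff_lead_coeff_pos[OF deg lead] deg by (simp add: degree_pcompose)
  moreover have "degree ?q = degree p" by (simp add: degree_pcompose)
  ultimately have "lead_coeff (?r + ?q) = lead_coeff ?q" by (intro lead_coeff_add_le) simp
  also have "\<dots> = lead_coeff p" by (subst lead_coeff_comp) auto
  finally have "eventually (\<lambda>v. poly (?r + ?q) v > 0) at_top" using lead by (intro poly_eventually_pos) simp
  then show ?thesis by eventually_elim (simp add: poly_pcompose algebra_simps)
qed

text \<open>Carries \<open>avoid\<close> over to the periodic extension. The representative
  \<open>y\<close> of \<open>x\<close> lies in \<open>1, ..., s\<close>, and the bounds on
  \<open>poly p z\<close> place \<open>p z - y\<close> in \<open>1, ..., N\<close>, where the
  extension agrees with \<chi>.\<close>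

lemma periodic_reflection:
  assumes s: "s > 0" "\<And>x. 1 \<le> x \<Longrightarrow> x + s \<le> N \<Longrightarrow> \<chi> (x + s) = \<chi> x"
    and z: "z \<ge> z0" "s < poly p z" "poly p z \<le> N + 1"
    and f: "f = (\<lambda>x. \<chi> ((x - 1) mod s + 1))" and x: "f x = \<chi> z"
  shows "f (poly p z - x) \<noteq> \<chi> z"
proof -
  define y where "y = (x - 1) mod s + 1"
  have y: "1 \<le> y" "y \<le> s" using s by (auto simp: y_def add1_zle_eq)
  have "(poly p z - x - 1) mod s = (poly p z - y - 1) mod s"
    using mod_diff_right_eq[of "poly p z - 2" "x - 1" s] by (simp add: y_def algebra_simps)
  then have "f (poly p z - x) = \<chi> (poly p z - y)"
    using shift_invariant_cong[where \<chi> = \<chi>, OF s, of N "poly p z - y"] y z by (simp add: f)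
  moreover have "\<chi> (poly p z - y) \<noteq> \<chi> z" using avoid[of z y] y z x by (simp add: f y_def)
  ultimately show ?thesis by simp
qed

text \<open>Points of opposite colours give reflections that exchange the colours in opposite
  directions, so their centres differ by a period. Points of equal colour are compared through
  \<open>a\<close> and \<open>b\<close>.\<close>

lemma reflection_differences_periods:
  assumes per: "s > 0" "s \<in> periods f"
    and refl: "\<And>z x. z \<in> Z \<Longrightarrow> f x = \<chi> z \<Longrightarrow> f (poly p z - x) \<noteq> \<chi> z"
    and ab: "a \<in> Z" "b \<in> Z" "\<chi> a" "\<not> \<chi> b" and yz: "y \<in> Z" "z \<in> Z"
  shows "poly p z - poly p y \<in> periods f"
proof -
  have opp: "poly p v - poly p u \<in> periods f" if "u \<in> Z" "v \<in> Z" "\<chi> u" "\<not> \<chi> v" for u v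
    using refl[of u] refl[of v] that by (intro reflections_differ_by_period[OF per]) auto
  have "poly p u - poly p b \<in> periods f" if "u \<in> Z" for u
  proof (cases "\<chi> u")
    case True
    then show ?thesis using periods_uminus[OF opp[of u b]] that ab by simp
  next
    case False
    then show ?thesis using periods_diff[OF opp[of a u] opp[of a b]] that ab by simp
  qed
  from periods_diff[OF this[OF yz(2)] this[OF yz(1)]] show ?thesis by simp
qed

lemma periodic: "\<exists>K>0. \<forall>x\<ge>1. \<chi> (x + K) = \<chi> x"
proof -
  define d where "d = int (degree p)"
  have d: "d \<ge> 1" "int (degree (poly_diff p)) = d - 1"
    using poly_diff_lead_coeff_pos[OF deg lead] deg by (auto simp: d_def)
  note lD = poly_diff_lead_coeff_pos(1)[OF deg lead]
  \<comment> \<open>\<open>K\<close> is fixed before \<open>x\<close> and the changes are chosen.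
    The local period \<open>s\<close> may grow with the change, but every local group of periods
    will contain this same \<open>K\<close>.\<close>
  obtain K where K: "K > 0"
    "\<And>w f. \<forall>i\<in>{w..w + (d - 1)}. D i \<in> periods f \<Longrightarrow> K \<in> periods f"
    using finite_difference_period[OF lD] unfolding d(2) by blast
  have "eventually (\<lambda>v. D v > 0 \<and> (\<forall>y\<ge>v. D v \<le> D y) \<and> (\<forall>y\<ge>v. poly p v \<le> poly p y) \<and>
      2 * D (2 * v + 1) < poly p (v - d) \<and> v \<ge> max z0 0) at_top"
    unfolding d_def
    by (intro eventually_conj poly_eventually_pos poly_eventually_mono difference_eventually_small
        eventually_ge_at_top lD lead)
  then obtain n where n: "\<And>v. v \<ge> n \<Longrightarrow> D v > 0 \<and> (\<forall>y\<ge>v. D v \<le> D y) \<and> (\<forall>y\<ge>v. poly p v \<le> poly p y) \<and>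
      2 * D (2 * v + 1) < poly p (v - d) \<and> v \<ge> max z0 0"
    unfolding eventually_at_top_linorder by blast
  have "\<chi> (x + K) = \<chi> x" if "x \<ge> 1" for x
  proof -
    have "eventually (\<lambda>v. poly p v \<ge> x + K + 1 \<and> v \<ge> n + d) at_top"
      by (intro eventually_conj poly_eventually_ge deg lead eventually_ge_at_top)
    then obtain M where M: "\<And>v. v \<ge> M \<Longrightarrow> poly p v \<ge> x + K + 1 \<and> v \<ge> n + d"
      unfolding eventually_at_top_linorder by blast
    obtain v v' where v: "v \<ge> M" "v' \<ge> v" "\<not> \<chi> v" "\<chi> (v + 1)" "\<chi> v'" "\<not> \<chi> (v' + 1)"
        "v' \<le> 2 * v + 1 \<or> degree p = 1"
      using close_changes[of M] by blast
    have vn: "v \<ge> n" "v - d \<ge> n" "v \<ge> z0" "v \<ge> 0" using M[OF v(1)] d n[of v] by auto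
    \<comment> \<open>With this bound \<open>y + D v \<le> N\<close> gives \<open>y < p v\<close>,
      as the shift at \<open>v\<close> requires. Since \<open>v \<le> v'\<close>, the same bound
      serves the shift at \<open>v'\<close>.\<close>
    define N where "N = poly p (v + 1) - 1"
    define s where "s = D v'"
    have pmono: "poly p a \<le> poly p b" if "n \<le> a" "a \<le> b" for a b using n[of a] that by blast
    have const: "D a = D b" if "degree p = 1" for a b
    proof -
      have "degree (poly_diff p) = 0" using d that by (simp add: d_def)
      then obtain c where "poly_diff p = [:c:]" using degree_0_id by metis
      then show ?thesis by simp
    qed
    have Dn: "D a \<le> D b" if "n \<le> a" "a \<le> b" for a b using n[of a] that by blast
    have "s \<le> D (2 * v + 1)"
      using v(7) const[of v' "2 * v + 1"] Dn[of v' "2 * v + 1"] vn v by (auto simp: s_def)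
    moreover have "D v \<le> D (2 * v + 1)" using Dn vn by simp
    \<comment> \<open>This gives \<open>s + D v \<le> N\<close>, so that the two shifts can be
      combined, and \<open>s < p z\<close> for every reflection with \<open>z\<close> between
      \<open>v - d\<close> and \<open>v + 1\<close>.\<close>
    ultimately have small: "s + D v < poly p (v - d)" using n[OF vn(1)] by linarith
    have pos: "s > 0" "D v > 0" using n[of v] n[of v'] vn v by (auto simp: s_def)
    have pN: "poly p (v - d) \<le> poly p v" "poly p v \<le> N" "poly p v' \<ge> poly p v"
      using pmono vn d v pos n[of v] by (auto simp: N_def poly_poly_diff)
    have per: "\<chi> (y + s) = \<chi> y" if "1 \<le> y" "y + s \<le> N" for y
    proof (rule opposite_shifts_imp_period[of s "D v" N \<chi> y])
      show "\<chi> (y + s)" if "1 \<le> y" "y + s \<le> N" "\<chi> y" for y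
      proof -
        have "poly p (v + 1) \<le> poly p (v' + 1)" using pmono vn v by simp
        then have "y < poly p v'" using that by (simp add: N_def s_def poly_poly_diff)
        then show ?thesis using shift_at_change[of v' y] that v vn pos by (simp add: s_def)
      qed
      show "\<chi> y" if "1 \<le> y" "y + D v \<le> N" "\<chi> (y + D v)" for y
        using shift_at_change[of v y] that v vn pos by (auto simp: N_def poly_poly_diff)
    qed (use pos small pN that in auto)
    define f where "f = (\<lambda>y. \<chi> ((y - 1) mod s + 1))"
    have sp: "s \<in> periods f" unfolding f_def by (rule periodic_extension)
    \<comment> \<open>These are \<open>d\<close> consecutive differences, as many as a polynomial
      \<open>D\<close> of degree \<open>d - 1\<close> needs. The reflection range includes
      \<open>v\<close> and \<open>v + 1\<close>, which supply both colours.\<close>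
    have "poly p (i + 1) - poly p i \<in> periods f" if "i \<in> {v - d + 1..v - d + 1 + (d - 1)}" for i
    proof (rule reflection_differences_periods[OF pos(1) sp, of "{v - d..v + 1}"])
      fix z y assume zy: "z \<in> {v - d..v + 1}" "f y = \<chi> z"
      have "poly p (v - d) \<le> poly p z" "poly p z \<le> poly p (v + 1)"
        using zy vn by (auto intro!: pmono)
      moreover have "z \<ge> z0" using n[of "v - d"] vn zy by auto
      ultimately show "f (poly p z - y) \<noteq> \<chi> z"
        using small pos(2) by (intro periodic_reflection[of s N, OF pos(1) per _ _ _ f_def zy(2)]) (auto simp: N_def)
    qed (use v d that in auto)
    then have "K \<in> periods f" by (intro K(2)[of "v - d + 1"]) (auto simp: poly_poly_diff)
    then have "f (x + K) = f x" by (rule periods_shift)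
    moreover have "f y = \<chi> y" if "1 \<le> y" "y \<le> N" for y
      unfolding f_def by (rule shift_invariant_cong[where N = N]) (use pos(1) per that in auto)
    ultimately show ?thesis using that K(1) M[OF v(1)] pN by simp
  qed
  then show ?thesis using K(1) by blast
qed

lemma periodic_colouring:
  "\<exists>f K. K > 0 \<and> K \<in> periods f \<and> (\<forall>x\<ge>1. f x = \<chi> x) \<and>
     (\<forall>y z. poly p z - poly p y \<in> periods f) \<and> (\<forall>z x. f (poly p z - x) = (\<not> f x))"
proof -
  obtain K where K: "K > 0" "\<And>x. x \<ge> 1 \<Longrightarrow> \<chi> (x + K) = \<chi> x" using periodic by blast
  define f where "f = (\<lambda>x. \<chi> ((x - 1) mod K + 1))"
  have Kp: "K \<in> periods f" unfolding f_def by (rule periodic_extension)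
  have f_eq: "f x = \<chi> x" if "x \<ge> 1" for x
    unfolding f_def by (rule shift_invariant_cong[where N = x]) (use K that in auto)
  have "eventually (\<lambda>z. poly p z \<ge> K + 1 \<and> z \<ge> z0) at_top"
    by (intro eventually_conj poly_eventually_ge deg lead eventually_ge_at_top)
  then obtain n where n: "\<And>z. z \<ge> n \<Longrightarrow> poly p z \<ge> K + 1 \<and> z \<ge> z0"
    unfolding eventually_at_top_linorder by blast
  have refl: "f (poly p z - x) \<noteq> \<chi> z" if "z \<in> {n..}" "f x = \<chi> z" for z x
    by (rule periodic_reflection[of K "poly p z", OF K(1) _ _ _ _ f_def that(2)])
      (use K(2) n[of z] that in auto)
  obtain a where a: "a \<ge> n" "\<chi> a = True" using colour_unbounded by blast
  obtain b where b: "b \<ge> n" "\<chi> b = False" using colour_unbounded by blast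
  have far: "poly p z - poly p y \<in> periods f" if "y \<ge> n" "z \<ge> n" for y z
    using reflection_differences_periods[of K f "{n..}" a b y z] K(1) Kp refl a b that by auto
  have near: "poly p z - poly p a \<in> periods f" for z
  proof -
    \<comment> \<open>Adding a multiple of \<open>K\<close> moves \<open>z\<close> beyond
      \<open>n\<close> and changes the value of \<open>p\<close> only by a multiple of
      \<open>K\<close>, hence by a period.\<close>
    define w where "w = z + K * max 0 (n - z)"
    have "max 0 (n - z) \<le> K * max 0 (n - z)" using mult_right_mono[of 1 K "max 0 (n - z)"] K(1) by simp
    then have "w \<ge> n" by (simp add: w_def)
    have "K dvd poly p w - poly p z"
      using diff_dvd_poly_diff[of w z p] by (auto simp: w_def intro: dvd_trans)
    then have "poly p w - poly p z \<in> periods f"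
      using periods_mult[OF Kp] by (auto simp: mult.commute[of K] elim!: dvdE)
    from periods_diff[OF far[OF a(1) \<open>w \<ge> n\<close>] this] show ?thesis by simp
  qed
  have diff: "poly p z - poly p y \<in> periods f" for y z
    using periods_diff[OF near[of z] near[of y]] by simp
  \<comment> \<open>All values of \<open>p\<close> now give the same reflection. Taken at
    \<open>a\<close> it sends true to false, and taken at \<open>b\<close> false to true.\<close>
  have "f (poly p z - x) = (\<not> f x)" for z x
  proof -
    have "f (poly p z - x) = f (poly p w - x)" for w
      using periods_shift[OF diff[of z w], of "poly p w - x"] by (simp add: algebra_simps)
    then show ?thesis using refl[of a x] refl[of b x] a b by auto
  qed
  then show ?thesis using K(1) Kp f_eq diff by blast
qed

end

section \<open>Residue classes modulo the minimal period\<close>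

lemma minimal_period:
  assumes "K > 0" "K \<in> periods f"
  obtains m :: nat where "m > 0" "int m \<in> periods f" "\<And>h. h \<in> periods f \<Longrightarrow> int m dvd h"
proof -
  define m where "m = (LEAST m. m > 0 \<and> int m \<in> periods f)"
  have "nat K > 0 \<and> int (nat K) \<in> periods f" using assms by simp
  then have m: "m > 0 \<and> int m \<in> periods f" unfolding m_def by (rule LeastI)
  have "int m dvd h" if "h \<in> periods f" for h
  proof (rule ccontr)
    assume "\<not> int m dvd h"
    then have pos: "h mod int m \<noteq> 0" "h mod int m \<ge> 0" "h mod int m < int m" using m by (auto simp: dvd_eq_mod_eq_0)
    have "h - (h div int m) * int m \<in> periods f" using m that by (intro periods_diff periods_mult) auto
    then have "nat (h mod int m) > 0 \<and> int (nat (h mod int m)) \<in> periods f"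
      using pos by (simp add: minus_div_mult_eq_mod)
    then have "m \<le> nat (h mod int m)" unfolding m_def by (rule Least_le)
    then show False using pos by linarith
  qed
  then show thesis using that m by blast
qed

lemma set_add_residue_ring:
  "A <+>\<^bsub>residue_ring m\<^esub> B = {(a + b) mod m |a b. a \<in> A \<and> b \<in> B}"
  by (auto simp: set_add_def' residue_ring_def)

text \<open>A sum equal to \<alpha> would make one summand the reflection of the other, hence of the
  other colour. A second missing residue would be the centre of another reflection, and minimality
  of \<open>m\<close> identifies it with \<alpha>. The parameter \<open>c\<close> covers both
  classes.\<close>

lemma sumset_of_colour_class:
  fixes c :: bool
  assumes m: "m > 0" "m \<in> periods f" "\<And>h. h \<in> periods f \<Longrightarrow> m dvd h"
    and alpha: "\<And>x. f (\<alpha> - x) = (\<not> f x)" "0 \<le> \<alpha>" "\<alpha> < m"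
    and C: "C = {x \<in> {0..m - 1}. f x = c}"
  shows "C <+>\<^bsub>residue_ring m\<^esub> C = {0..m - 1} - {\<alpha>}"
proof (intro equalityI subsetI)
  fix y assume "y \<in> C <+>\<^bsub>residue_ring m\<^esub> C"
  then obtain a b where ab: "y = (a + b) mod m" "f a = c" "f b = c"
    by (auto simp: set_add_residue_ring C)
  have "y \<noteq> \<alpha>"
  proof
    assume "y = \<alpha>"
    then have "b mod m = (\<alpha> - a) mod m" using mod_diff_left_eq[of "a + b" m a] ab(1) by simp
    then have "f b = f (\<alpha> - a)" using periods_mod[OF m(2)] by metis
    then show False using alpha(1) ab by simp
  qed
  then show "y \<in> {0..m - 1} - {\<alpha>}" using ab m(1) by (simp add: zle_diff1_eq)
next
  fix y assume y: "y \<in> {0..m - 1} - {\<alpha>}"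
  have "\<exists>x. f x = c \<and> f (y - x) = c"
  proof (rule ccontr)
    assume "\<not> ?thesis"
    then have refl: "\<And>x. f x = c \<Longrightarrow> f (y - x) \<noteq> c" by blast
    have "\<alpha> - y \<in> periods f"
    \<comment> \<open>The reflection in \<open>y\<close> is known in one direction only, from
      \<open>c\<close> to its negation. The colour \<open>c\<close> decides which of the two
      reflections comes first, and so the sign of the period.\<close>
    proof (cases c)
      case True
      then show ?thesis using refl alpha(1) by (intro reflections_differ_by_period[OF m(1,2)]) auto
    next
      case False
      then have "y - \<alpha> \<in> periods f"
        using refl alpha(1) by (intro reflections_differ_by_period[OF m(1,2)]) auto
      then show ?thesis using periods_uminus[of "y - \<alpha>"] by simp
    qed
    then have "y mod m = \<alpha> mod m" using m(3) mod_eq_dvd_iff[of \<alpha> m y] by auto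
    then show False using y alpha by simp
  qed
  then obtain x where x: "f x = c" "f (y - x) = c" by blast
  have "y = (x mod m + (y - x) mod m) mod m" using y by (simp add: mod_add_eq)
  moreover have "x mod m \<in> C" "(y - x) mod m \<in> C"
    using x m(1) periods_mod[OF m(2)] by (auto simp: C zle_diff1_eq)
  ultimately show "y \<in> C <+>\<^bsub>residue_ring m\<^esub> C"
    unfolding set_add_residue_ring by blast
qed

lemma card_colour_classes:
  assumes m: "m > 0" "m \<in> periods f" and alpha: "\<And>x. f (\<alpha> - x) = (\<not> f x)"
  shows "card {x \<in> {0..m - 1}. f x} = card {x \<in> {0..m - 1}. \<not> f x}"
proof (rule bij_betw_same_card)
  have inv: "(\<alpha> - (\<alpha> - x) mod m) mod m = x" if "x \<in> {0..m - 1}" for x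
    using that by (simp add: mod_diff_right_eq)
  show "bij_betw (\<lambda>x. (\<alpha> - x) mod m) {x \<in> {0..m - 1}. f x} {x \<in> {0..m - 1}. \<not> f x}"
    by (rule bij_betw_byWitness[where f' = "\<lambda>x. (\<alpha> - x) mod m"])
      (use inv m(1) in \<open>auto simp: periods_mod[OF m(2)] alpha zle_diff1_eq\<close>)
qed

section \<open>Passage from the given colouring to the partition\<close>

lemma sum_avoiding_of_finite:
  assumes "degree p \<ge> 1" "lead_coeff p > 0" "two_colouring \<phi>" "finite (mono_solutions \<phi> p)"
  shows "\<exists>z0. sum_avoiding p (\<lambda>x. \<phi> (nat x) = -1) z0"
proof -
  have "finite ((\<lambda>(x, y, z). z) ` mono_solutions \<phi> p)" using assms(4) by simp
  then obtain k where k: "\<And>x y z. (x, y, z) \<in> mono_solutions \<phi> p \<Longrightarrow> z \<le> k"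
    by (force simp: finite_nat_set_iff_bounded_le)
  have "sum_avoiding p (\<lambda>x. \<phi> (nat x) = -1) (int k + 1)"
  proof
    fix x z assume z: "int k + 1 \<le> z" and x: "1 \<le> x" "x < poly p z"
      and same: "(\<phi> (nat x) = -1) = (\<phi> (nat z) = -1)"
    show "(\<phi> (nat (poly p z - x)) = -1) \<noteq> (\<phi> (nat z) = -1)"
    proof
      assume same': "(\<phi> (nat (poly p z - x)) = -1) = (\<phi> (nat z) = -1)"
      \<comment> \<open>Agreement about being -1 amounts to equality of colours because only two
        values occur at positive arguments.\<close>
      have col: "\<phi> (nat y) = 1 \<or> \<phi> (nat y) = -1" if "y \<ge> 1" for y
        using assms(3) that unfolding two_colouring_def by (metis Suc_eq_plus1 One_nat_def insertE nat_mono nat_one_as_int singletonD)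
      have "(nat x, nat (poly p z - x), nat z) \<in> mono_solutions \<phi> p"
        using same same' col[of x] col[of z] col[of "poly p z - x"] x z
        by (auto simp: mono_solutions_def)
      from k[OF this] show False using z by linarith
    qed
  qed (use assms in auto)
  then show ?thesis by blast
qed

theorem theorem1p2:
  fixes p :: "int poly" and \<phi> :: "nat \<Rightarrow> int"
  assumes "degree p \<ge> 1"
    and "lead_coeff p > 0"
    and "two_colouring \<phi>"
    and "\<not> infinite (mono_solutions \<phi> p)"
  shows "\<exists>(m::nat) (A::int set) (B::int set).
           m > 0 \<and> even m \<and>
           A \<union> B = carrier (residue_ring (int m)) \<and> A \<inter> B = {} \<and>
           card A = m div 2 \<and> card B = m div 2 \<and>
           (\<forall>x\<ge>1. \<phi> x = -1 \<longleftrightarrow> int x mod int m \<in> A) \<and>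
           (\<exists>\<alpha>\<in>carrier (residue_ring (int m)). odd \<alpha> \<and>
              A <+>\<^bsub>residue_ring (int m)\<^esub> A = carrier (residue_ring (int m)) - {\<alpha>} \<and>
              B <+>\<^bsub>residue_ring (int m)\<^esub> B = carrier (residue_ring (int m)) - {\<alpha>} \<and>
              (\<forall>z::nat. z \<ge> 1 \<longrightarrow> [poly p (int z) = \<alpha>] (mod int m)))"
proof -
  obtain z0 where "sum_avoiding p (\<lambda>x. \<phi> (nat x) = -1) z0"
    using sum_avoiding_of_finite assms by blast
  from sum_avoiding.periodic_colouring[OF this] obtain f K where f: "K > 0" "K \<in> periods f"
      "\<And>x. x \<ge> 1 \<Longrightarrow> f x = (\<phi> (nat x) = -1)"
      "\<And>y z. poly p z - poly p y \<in> periods f" "\<And>z x. f (poly p z - x) = (\<not> f x)"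
    by blast
  obtain m where m: "m > 0" "int m \<in> periods f" "\<And>h. h \<in> periods f \<Longrightarrow> int m dvd h"
    using minimal_period[OF f(1,2)] by blast
  define \<alpha> where "\<alpha> = poly p 1 mod int m"
  define A where "A = {x \<in> {0..int m - 1}. f x = True}"
  define B where "B = {x \<in> {0..int m - 1}. f x = False}"
  have carrier: "carrier (residue_ring (int m)) = {0..int m - 1}" by (simp add: residue_ring_def)
  have alpha: "0 \<le> \<alpha>" "\<alpha> < int m" using m(1) by (auto simp: \<alpha>_def)
  have refl: "f (\<alpha> - x) = (\<not> f x)" for x
  proof -
    have "f (\<alpha> - x) = f ((\<alpha> - x) mod int m)" using periods_mod[OF m(2)] by simp
    also have "(\<alpha> - x) mod int m = (poly p 1 - x) mod int m" by (simp add: \<alpha>_def mod_diff_left_eq)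
    finally show ?thesis using periods_mod[OF m(2)] f(5) by simp
  qed
  have AB: "A \<union> B = {0..int m - 1}" "A \<inter> B = {}" by (auto simp: A_def B_def)
  have "card A = card B"
    using card_colour_classes[OF _ m(2) refl] m(1) by (simp add: A_def B_def)
  moreover have "card A + card B = m"
  proof -
    have "finite A" "finite B" using AB(1) finite_Un[of A B] by simp_all
    then show ?thesis using card_Un_disjoint[of A B] AB by simp
  qed
  ultimately have card: "even m" "card A = m div 2" "card B = m div 2" by auto
  \<comment> \<open>For \<alpha> \<open>= 2 * b\<close> the reflection would fix \<open>b\<close>
    and yet change its colour.\<close>
  have odd: "odd \<alpha>"
  proof
    assume "even \<alpha>"
    then obtain b where "\<alpha> = 2 * b" by blast
    then show False using refl[of b] by simp
  qed
  have const: "[poly p z = \<alpha>] (mod int m)" for z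
    using m(3)[OF f(4)[of z 1]] by (simp add: \<alpha>_def cong_def mod_eq_dvd_iff)
  have col: "\<phi> x = -1 \<longleftrightarrow> int x mod int m \<in> A" if "x \<ge> 1" for x
    using f(3)[of "int x"] periods_mod[OF m(2), of "int x"] that m(1)
    by (simp add: A_def zle_diff1_eq)
  have "int m > 0" using m(1) by simp
  note sumset = sumset_of_colour_class[OF this m(2,3) refl alpha A_def]
    sumset_of_colour_class[OF this m(2,3) refl alpha B_def]
  show ?thesis
    unfolding carrier
  proof (rule exI[of _ m], rule exI[of _ A], rule exI[of _ B], intro conjI bexI[of _ \<alpha>])
    show "\<alpha> \<in> carrier (residue_ring (int m))" using alpha by (simp add: carrier)
    show "\<forall>x\<ge>1. \<phi> x = -1 \<longleftrightarrow> int x mod int m \<in> A" using col by blast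
    show "\<forall>z::nat. z \<ge> 1 \<longrightarrow> [poly p (int z) = \<alpha>] (mod int m)" using const by blast
  qed (use m(1) card AB odd sumset carrier in simp_all)
qed

end
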